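(* Let $\Xi=(\Xi_t)_{t\in[0,1]}$ be a centered Gauss-Markov process with $\Xi_0=0$, non-degenerate on the open interval $(0,1)$, with covariance kernel $K_\Xi(s,t)=u(s)v(t)$ for $0\le s\le t\le 1$, where $u$, $v$ and $q=u/v$ are as described in the context. Assume $q(0)=0$ and put $T=q(1)$. Then the reproducing kernel Hilbert space $\mathcal H(\Xi)$ associated with the covariance kernel $K_\Xi$ is $$\mathcal H(\Xi)=\Bigl\{F:[0,1]\to\mathbb R\ \Big|\ F(t)=v(t)\int_0^{q(t)}g(x)\,\mathrm dx\ \text{ for some } g\in L^2([0,T])\Bigr\},$$ and this space is equipped with the norm $\|F\|_{\mathcal H(\Xi)}=\|g\|_{L^2([0,T])}$ for $F$ represented by $g$ as in this display.
   Context: A Gauss-Markov process is a stochastic process that is both Gaussian and Markov, and $K_\Xi(s,t)=\operatorname{Cov}(\Xi_s,\Xi_t)=\mathbf E[\Xi_s\Xi_t]$. For a process $\Xi$ as in the claim there exist functions $u,v$ on $[0,1]$ with $K_\Xi(s,t)=u(s)v(t)$ for $0\le s\le t\le 1$ such that $u(t)v(t)\ge 0$ on $[0,1]$, $u(t)v(t)>0$ on $(0,1)$, and such that the function $q(t)=u(t)/v(t)$ is continuous on $[0,1)$ and non-negative and strictly increasing on $[0,1]$; $u$ and $v$ denote such functions. $\mathcal H(\Xi)$ is the unique Hilbert space of real-valued functions on $[0,1]$ with bounded evaluation functionals whose reproducing kernel is $K_\Xi$, i.e. $K_\Xi(\cdot,t)\in\mathcal H(\Xi)$ and $F(t)=\langle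 F,K_\Xi(\cdot,t)\rangle_{\mathcal H(\Xi)}$ for all $F\in\mathcal H(\Xi)$, $t\in[0,1]$. $L^2([0,T])$ is the space of square-integrable real functions on $[0,T]$.
   Formalization: The norm identity ‖F‖=‖g‖ for every representing g is claimed only if q is left-continuous at 1; if q jumps at 1 it fails (a nonzero g may represent F=0), and ‖F‖ is then the minimum of ‖g‖ over all g representing F. *)

theory Defs
  imports "HOL-Probability.Probability"
begin

section \<open>Gauss-Markov processes on the unit interval\<close>

text \<open>Point masses count as Gaussian laws.\<close>

definition gaussian_rv :: "'a measure \<Rightarrow> ('a \<Rightarrow> real) \<Rightarrow> bool" where
  "gaussian_rv M X \<longleftrightarrow> X \<in> borel_measurable M \<and>
     (\<exists>\<mu>. (AE \<omega> in M. X \<omega> = \<mu>) \<or>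
          (\<exists>\<sigma>>0. distributed M lborel X (\<lambda>x. ennreal (normal_density \<mu> \<sigma> x))))"

definition gaussian_process :: "'a measure \<Rightarrow> (real \<Rightarrow> 'a \<Rightarrow> real) \<Rightarrow> bool" where
  "gaussian_process M X \<longleftrightarrow>
     (\<forall>J c. finite J \<and> J \<subseteq> {0..1} \<longrightarrow> gaussian_rv M (\<lambda>\<omega>. \<Sum>t\<in>J. c t * X t \<omega>))"

definition sigma_gen :: "'a measure \<Rightarrow> (real \<Rightarrow> 'a \<Rightarrow> real) \<Rightarrow> real set \<Rightarrow> 'a measure" where
  "sigma_gen M X I = sigma (space M) {X r -` B \<inter> space M | r B. r \<in> I \<and> B \<in> sets borel}"

definition markov_process :: "'a measure \<Rightarrow> (real \<Rightarrow> 'a \<Rightarrow> real) \<Rightarrow> bool" where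
  "markov_process M X \<longleftrightarrow>
     (\<forall>t\<in>{0..1}. X t \<in> borel_measurable M) \<and>
     (\<forall>s t. 0 \<le> s \<and> s \<le> t \<and> t \<le> 1 \<longrightarrow> (\<forall>B\<in>sets borel.
        AE \<omega> in M.
          real_cond_exp M (sigma_gen M X {0..s}) (\<lambda>\<omega>. indicator B (X t \<omega>)) \<omega> =
          real_cond_exp M (sigma_gen M X {s}) (\<lambda>\<omega>. indicator B (X t \<omega>)) \<omega>))"

definition cov_kernel :: "'a measure \<Rightarrow> (real \<Rightarrow> 'a \<Rightarrow> real) \<Rightarrow> real \<Rightarrow> real \<Rightarrow> real" where
  "cov_kernel M X s t =
     (LINT \<omega>|M. (X s \<omega> - (LINT \<omega>'|M. X s \<omega>')) * (X t \<omega> - (LINT \<omega>'|M. X t \<omega>')))"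

section \<open>Reproducing kernel Hilbert spaces\<close>

text \<open>
  Functions on \<open>A\<close> are elements of \<open>extensional A\<close>, so that equality of functions is
  equality on \<open>A\<close>.  The values of the inner product outside \<open>H\<close> are irrelevant.
\<close>

definition fnorm :: "(('b \<Rightarrow> real) \<Rightarrow> ('b \<Rightarrow> real) \<Rightarrow> real) \<Rightarrow> ('b \<Rightarrow> real) \<Rightarrow> real" where
  "fnorm ip F = sqrt (ip F F)"

locale hilbert_function_space =
  fixes A :: "'b set"
    and H :: "('b \<Rightarrow> real) set"
    and ip :: "('b \<Rightarrow> real) \<Rightarrow> ('b \<Rightarrow> real) \<Rightarrow> real"
  assumes carrier: "H \<subseteq> extensional A"
    and zero: "(\<lambda>x\<in>A. 0) \<in> H"
    and add: "F \<in> H \<Longrightarrow> G \<in> H \<Longrightarrow> (\<lambda>x\<in>A. F x + G x) \<in> H"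
    and scale: "F \<in> H \<Longrightarrow> (\<lambda>x\<in>A. c * F x) \<in> H"
    and ip_commute: "F \<in> H \<Longrightarrow> G \<in> H \<Longrightarrow> ip F G = ip G F"
    and ip_add: "F \<in> H \<Longrightarrow> G \<in> H \<Longrightarrow> E \<in> H \<Longrightarrow> ip (\<lambda>x\<in>A. F x + G x) E = ip F E + ip G E"
    and ip_scale: "F \<in> H \<Longrightarrow> G \<in> H \<Longrightarrow> ip (\<lambda>x\<in>A. c * F x) G = c * ip F G"
    and ip_pos: "F \<in> H \<Longrightarrow> F \<noteq> (\<lambda>x\<in>A. 0) \<Longrightarrow> 0 < ip F F"
    and complete:
      "(\<And>n::nat. S n \<in> H) \<Longrightarrow>
       (\<And>e. 0 < e \<Longrightarrow> \<exists>N. \<forall>m\<ge>N. \<forall>n\<ge>N. fnorm ip (\<lambda>x\<in>A. S m x - S n x) < e) \<Longrightarrow>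
       \<exists>F\<in>H. (\<lambda>n. fnorm ip (\<lambda>x\<in>A. S n x - F x)) \<longlonglongrightarrow> 0"

locale rkhs = hilbert_function_space A H ip
  for A :: "'b set"
    and K :: "'b \<Rightarrow> 'b \<Rightarrow> real"
    and H :: "('b \<Rightarrow> real) set"
    and ip :: "('b \<Rightarrow> real) \<Rightarrow> ('b \<Rightarrow> real) \<Rightarrow> real" +
  assumes bounded_eval: "t \<in> A \<Longrightarrow> \<exists>C. \<forall>F\<in>H. \<bar>F t\<bar> \<le> C * fnorm ip F"
    and kernel_mem: "t \<in> A \<Longrightarrow> (\<lambda>s\<in>A. K s t) \<in> H"
    and reproducing: "F \<in> H \<Longrightarrow> t \<in> A \<Longrightarrow> F t = ip F (\<lambda>s\<in>A. K s t)"

section \<open>Square-integrable functions and the integral representation\<close>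

text \<open>
  The right end point is an extended real: for bridge-type processes \<open>v 1 = 0\<close>, \<open>q 1 = \<infinity>\<close>,
  and the interval is then the half-line.
\<close>

definition seg :: "ereal \<Rightarrow> real set" where
  "seg a = {x. 0 \<le> x \<and> ereal x \<le> a}"

definition L2_space :: "ereal \<Rightarrow> (real \<Rightarrow> real) set" where
  "L2_space T = {g. g \<in> borel_measurable (lebesgue_on (seg T)) \<and>
                    integrable (lebesgue_on (seg T)) (\<lambda>x. (g x)\<^sup>2)}"

definition L2_norm :: "ereal \<Rightarrow> (real \<Rightarrow> real) \<Rightarrow> real" where
  "L2_norm T g = sqrt (LINT x|lebesgue_on (seg T). (g x)\<^sup>2)"

text \<open>
  If \<open>q t = \<infinity>\<close>, then \<open>t = 1\<close> and \<open>v 1 = 0\<close>, so the product is \<open>0\<close> even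
  when \<open>g\<close> is not integrable on the half-line.

  If \<open>q\<close> jumps at \<open>1\<close>, a function has several representing \<open>g\<close> with different
  norms; the norm of the function is then the smallest of them.
\<close>

definition represents ::
    "(real \<Rightarrow> real) \<Rightarrow> (real \<Rightarrow> ereal) \<Rightarrow> (real \<Rightarrow> real) \<Rightarrow> (real \<Rightarrow> real) \<Rightarrow> bool" where
  "represents v q g F \<longleftrightarrow> (\<forall>t\<in>{0..1}. F t = v t * (LINT x|lebesgue_on (seg (q t)). g x))"

end

theory Submission
  imports Defs
begin

text \<open>
  With \<open>\<phi>\<^sub>t = v t \<cdot> 1\<^bsub>[0, q t]\<^esub>\<close> in \<open>L\<^sup>2([0, T])\<close> one has \<open>K s t = \<langle>\<phi>\<^sub>s, \<phi>\<^sub>t\<rangle>\<close>, and \<open>g\<close>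
  represents \<open>F\<close> iff \<open>F t = \<langle>g, \<phi>\<^sub>t\<rangle>\<close> for all \<open>t\<close>.  If two families in Hilbert spaces have the same
  Gram matrix, then the values \<open>\<langle>g, \<phi>\<^sub>t\<rangle>\<close> of any vector \<open>g\<close> of one space are also attained by a vector
  of the other one whose norm is not larger.  Applied in both directions to \<open>\<phi>\<close> and to the kernel
  functions of any reproducing kernel Hilbert space, this identifies the space and its norm, as
  the least norm of a representing function.  If \<open>q\<close> does not jump at \<open>1\<close>, a difference of two
  representing functions has integral zero over all \<open>[0, y]\<close> with \<open>y < T\<close>, so it vanishes almost
  everywhere.
\<close>

section \<open>Transfer between families with equal Gram matrices\<close>

text \<open>No vector space laws are assumed for \<open>plus\<close> and \<open>smult\<close>: everything happens up to
  the seminorm of \<open>B\<close>, so functions need not be identified almost everywhere.\<close>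

locale semi_inner_space =
  fixes V :: "'v set" and plus :: "'v \<Rightarrow> 'v \<Rightarrow> 'v" and smult :: "real \<Rightarrow> 'v \<Rightarrow> 'v"
    and B :: "'v \<Rightarrow> 'v \<Rightarrow> real"
  assumes plus_mem: "x \<in> V \<Longrightarrow> y \<in> V \<Longrightarrow> plus x y \<in> V"
    and smult_mem: "x \<in> V \<Longrightarrow> smult c x \<in> V"
    and B_commute: "x \<in> V \<Longrightarrow> y \<in> V \<Longrightarrow> B x y = B y x"
    and B_plus: "x \<in> V \<Longrightarrow> y \<in> V \<Longrightarrow> z \<in> V \<Longrightarrow> B (plus x y) z = B x z + B y z"
    and B_smult: "x \<in> V \<Longrightarrow> y \<in> V \<Longrightarrow> B (smult c x) y = c * B x y"
    and B_nonneg: "x \<in> V \<Longrightarrow> 0 \<le> B x x"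
begin

text \<open>The squared seminorm of a difference, in expanded form because the locale has no
  subtraction.\<close>

definition dist2 :: "'v \<Rightarrow> 'v \<Rightarrow> real" where
  "dist2 x y = B x x - 2 * B x y + B y y"

lemma B_plus_right: "x \<in> V \<Longrightarrow> y \<in> V \<Longrightarrow> z \<in> V \<Longrightarrow> B z (plus x y) = B z x + B z y"
  by (metis B_commute B_plus plus_mem)

lemma B_smult_right: "x \<in> V \<Longrightarrow> y \<in> V \<Longrightarrow> B y (smult c x) = c * B y x"
  by (metis B_commute B_smult smult_mem)

lemmas B_simps = plus_mem smult_mem B_plus B_smult B_plus_right B_smult_right

lemma dist2_eq:
  assumes "x \<in> V" "y \<in> V"
  shows "dist2 x y = B (plus x (smult (-1) y)) (plus x (smult (-1) y))"
  using assms by (simp add: B_simps dist2_def B_commute[of y x])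

lemma dist2_nonneg: "x \<in> V \<Longrightarrow> y \<in> V \<Longrightarrow> 0 \<le> dist2 x y"
  by (simp add: dist2_eq B_nonneg plus_mem smult_mem)

text \<open>The form on \<open>x + c y\<close> is a nonnegative quadratic in \<open>c\<close>. Since
  \<open>B\<close> may be degenerate, \<open>B y y = 0\<close> is treated apart: the quadratic is
  then affine, so its slope must vanish.\<close>

lemma Cauchy_Schwarz:
  assumes x: "x \<in> V" and y: "y \<in> V"
  shows "(B x y)\<^sup>2 \<le> B x x * B y y"
proof -
  have quad: "0 \<le> B x x + 2 * c * B x y + c\<^sup>2 * B y y" for c
    using B_nonneg[of "plus x (smult c y)"] x y
    by (simp add: B_simps B_commute[of y x] power2_eq_square algebra_simps)
  show ?thesis
  proof (cases "B y y = 0")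
    case True
    show ?thesis
    proof (rule ccontr)
      assume "\<not> ?thesis"
      then have n0: "B x y \<noteq> 0" using True by auto
      \<comment> \<open>This \<open>c\<close> would give the affine function the value -1.\<close>
      have "0 \<le> B x x + 2 * (- (B x x + 1) / (2 * B x y)) * B x y"
        using quad[of "- (B x x + 1) / (2 * B x y)"] True by simp
      then show False using n0 by (simp add: field_simps)
    qed
  next
    case False
    then have pos: "0 < B y y" using B_nonneg[OF y] by simp
    \<comment> \<open>The minimiser of the quadratic; the factor \<open>B y y\<close> clears the
      denominator.\<close>
    have "0 \<le> B y y * (B x x + 2 * (- B x y / B y y) * B x y + (- B x y / B y y)\<^sup>2 * B y y)"
      using quad[of "- B x y / B y y"] pos by (intro mult_nonneg_nonneg) auto
    also have "\<dots> = B x x * B y y - (B x y)\<^sup>2"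
      using pos by (simp add: field_simps power2_eq_square)
    finally show ?thesis by simp
  qed
qed

lemma Cauchy_Schwarz_diff:
  assumes "x \<in> V" "y \<in> V" "z \<in> V"
  shows "(B x z - B y z)\<^sup>2 \<le> dist2 x y * B z z"
  using Cauchy_Schwarz[of "plus x (smult (-1) y)" z] assms
  by (simp add: B_simps dist2_eq[OF assms(1,2), unfolded B_simps])

lemma tendsto_B:
  assumes S: "\<And>n. S n \<in> V" and x: "x \<in> V" and z: "z \<in> V"
    and lim: "(\<lambda>n. dist2 (S n) x) \<longlonglongrightarrow> 0"
  shows "(\<lambda>n. B (S n) z) \<longlonglongrightarrow> B x z"
proof -
  have "(\<lambda>n. dist2 (S n) x * B z z) \<longlonglongrightarrow> 0"
    using tendsto_mult_right[OF lim, of "B z z"] by simp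
  then have "(\<lambda>n. (B (S n) z - B x z)\<^sup>2) \<longlonglongrightarrow> 0"
    by (rule tendsto_sandwich[OF _ _ tendsto_const, rotated 2])
       (intro always_eventually allI zero_le_power2 Cauchy_Schwarz_diff S x z)+
  then have "(\<lambda>n. B (S n) z - B x z) \<longlonglongrightarrow> 0"
    using tendsto_real_sqrt by (fastforce simp: tendsto_rabs_zero_iff)
  then show ?thesis by (simp add: LIM_zero_iff)
qed

end

locale semi_hilbert_space = semi_inner_space +
  assumes B_complete:
    "(\<And>n::nat. S n \<in> V) \<Longrightarrow>
     (\<And>e. 0 < e \<Longrightarrow> \<exists>N. \<forall>m\<ge>N. \<forall>n\<ge>N. dist2 (S m) (S n) < e) \<Longrightarrow>
     \<exists>x\<in>V. (\<lambda>n. dist2 (S n) x) \<longlonglongrightarrow> 0"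

text \<open>Pairs of the same linear combination of two families; carrying both members along avoids
  choosing coefficients.\<close>

inductive span_rel ::
  "('v \<Rightarrow> 'v \<Rightarrow> 'v) \<Rightarrow> (real \<Rightarrow> 'v \<Rightarrow> 'v) \<Rightarrow> ('w \<Rightarrow> 'w \<Rightarrow> 'w) \<Rightarrow> (real \<Rightarrow> 'w \<Rightarrow> 'w) \<Rightarrow>
   'b set \<Rightarrow> ('b \<Rightarrow> 'v) \<Rightarrow> ('b \<Rightarrow> 'w) \<Rightarrow> 'v \<Rightarrow> 'w \<Rightarrow> bool"
  for p1 s1 p2 s2 A \<phi> \<psi>
  where
    base: "t \<in> A \<Longrightarrow> span_rel p1 s1 p2 s2 A \<phi> \<psi> (\<phi> t) (\<psi> t)"
  | plus: "span_rel p1 s1 p2 s2 A \<phi> \<psi> x y \<Longrightarrow> span_rel p1 s1 p2 s2 A \<phi> \<psi> x' y' \<Longrightarrow>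
      span_rel p1 s1 p2 s2 A \<phi> \<psi> (p1 x x') (p2 y y')"
  | smult: "span_rel p1 s1 p2 s2 A \<phi> \<psi> x y \<Longrightarrow>
      span_rel p1 s1 p2 s2 A \<phi> \<psi> (s1 c x) (s2 c y)"

text \<open>\<open>W\<close> is the complete side because the transferred vector arises there as a
  limit. The locale is used in both directions between square-integrable functions and a reproducing
  kernel Hilbert space.\<close>

locale gram_pair =
  V: semi_inner_space V p1 s1 B1 + W: semi_hilbert_space W p2 s2 B2
  for V :: "'v set" and p1 s1 B1 and W :: "'w set" and p2 s2 B2 +
  fixes A :: "'b set" and \<phi> :: "'b \<Rightarrow> 'v" and \<psi> :: "'b \<Rightarrow> 'w"
  assumes nonempty: "A \<noteq> {}"
    and \<phi>: "t \<in> A \<Longrightarrow> \<phi> t \<in> V" and \<psi>: "t \<in> A \<Longrightarrow> \<psi> t \<in> W"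
    and gram: "s \<in> A \<Longrightarrow> t \<in> A \<Longrightarrow> B1 (\<phi> s) (\<phi> t) = B2 (\<psi> s) (\<psi> t)"
begin

abbreviation rel where "rel \<equiv> span_rel p1 s1 p2 s2 A \<phi> \<psi>"

lemma rel_mem: "rel x y \<Longrightarrow> x \<in> V \<and> y \<in> W"
  by (induction rule: span_rel.induct)
     (auto simp: \<phi> \<psi> V.plus_mem V.smult_mem W.plus_mem W.smult_mem)

lemma rel_B_base:
  assumes "rel x y" "t \<in> A"
  shows "B1 x (\<phi> t) = B2 y (\<psi> t)"
  using assms(1)
proof (induction rule: span_rel.induct)
  case (base s)
  then show ?case using gram assms(2) by simp
next
  case (plus x y x' y')
  then show ?case using rel_mem[OF plus.hyps(1)] rel_mem[OF plus.hyps(2)] assms(2)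
    by (simp add: V.B_plus W.B_plus \<phi> \<psi>)
next
  case (smult x y c)
  then show ?case using rel_mem[OF smult.hyps(1)] assms(2)
    by (simp add: V.B_smult W.B_smult \<phi> \<psi>)
qed

text \<open>Bilinear extension of the Gram identity: induction on the second pair, after
  \<open>rel_B_base\<close> has treated the first. Passing to partners therefore preserves
  distances.\<close>

lemma rel_B:
  assumes "rel x y" "rel x' y'"
  shows "B1 x x' = B2 y y'"
  using assms(2)
proof (induction rule: span_rel.induct)
  case (base t)
  then show ?case using rel_B_base assms(1) by simp
next
  case (plus x1 y1 x2 y2)
  then show ?case using rel_mem[OF plus.hyps(1)] rel_mem[OF plus.hyps(2)] rel_mem[OF assms(1)]
    by (simp add: V.B_plus_right W.B_plus_right)
next
  case (smult x1 y1 c)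
  then show ?case using rel_mem[OF smult.hyps(1)] rel_mem[OF assms(1)]
    by (simp add: V.B_smult_right W.B_smult_right)
qed

lemma rel_dist2: "rel x y \<Longrightarrow> rel x' y' \<Longrightarrow> V.dist2 x x' = W.dist2 y y'"
  by (simp add: V.dist2_def W.dist2_def rel_B)

lemma orthogonal_rel:
  assumes n: "n \<in> W" and orth: "\<And>t. t \<in> A \<Longrightarrow> B2 n (\<psi> t) = 0" and "rel x y"
  shows "B2 n y = 0"
  using assms(3)
proof (induction rule: span_rel.induct)
  case (plus x1 y1 x2 y2)
  then show ?case using rel_mem[OF plus.hyps(1)] rel_mem[OF plus.hyps(2)] n
    by (simp add: W.B_plus_right)
next
  case (smult x1 y1 c)
  then show ?case using rel_mem[OF smult.hyps(1)] n by (simp add: W.B_smult_right)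
qed (simp add: orth)

text \<open>The best approximations \<open>x n\<close> of \<open>g\<close> in the first span form a Cauchy sequence by the
  parallelogram law, hence so do their partners \<open>y n\<close> in the second one; \<open>h\<close> is the limit of the
  latter.\<close>

lemma transfer:
  assumes g: "g \<in> V"
  obtains h where "h \<in> W" "\<And>t. t \<in> A \<Longrightarrow> B2 h (\<psi> t) = B1 g (\<phi> t)" "B2 h h \<le> B1 g g"
    "\<And>n. n \<in> W \<Longrightarrow> (\<And>t. t \<in> A \<Longrightarrow> B2 n (\<psi> t) = 0) \<Longrightarrow> B2 h n = 0"
proof -
  define D where "D = {V.dist2 g x | x y. rel x y}"
  define d where "d = Inf D"
  obtain t0 where "t0 \<in> A" using nonempty by auto
  then have "V.dist2 g (\<phi> t0) \<in> D"
    unfolding D_def using span_rel.base[of t0 A] by fast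
  then have ne: "D \<noteq> {}" by auto
  have bdd: "bdd_below D"
    by (rule bdd_belowI[of _ 0]) (auto simp: D_def rel_mem V.dist2_nonneg g)
  have d_le: "d \<le> V.dist2 g x" if "rel x y" for x y
    unfolding d_def using that by (intro cInf_lower bdd) (auto simp: D_def)
  have "\<exists>x y. rel x y \<and> V.dist2 g x < d + inverse (Suc n)" for n :: nat
  proof -
    have "\<exists>a\<in>D. a < d + inverse (Suc n)"
      using cInf_lessD[OF ne, of "d + inverse (Suc n)"] by (auto simp: d_def)
    then show ?thesis by (auto simp: D_def)
  qed
  then obtain x y where xy: "\<And>n::nat. rel (x n) (y n)"
    and less: "\<And>n. V.dist2 g (x n) < d + inverse (Suc n)" by metis
  have x: "x n \<in> V" and y: "y n \<in> W" for n using rel_mem[OF xy] by auto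
  \<comment> \<open>The optimal step from \<open>x n\<close> along \<open>z\<close> lowers the
    squared distance to \<open>g\<close> by \<open>(B1 g z - B1 (x n) z)^2 / B1 z z\<close> and
    stays in the span, so this gain is at most the excess \<open>inverse (Suc n)\<close> over the
    infimum.\<close>
  have near_orth: "(B1 g z - B1 (x n) z)\<^sup>2 \<le> inverse (Suc n) * B1 z z"
    if z: "rel z w" for z w n
  proof (cases "B1 z z = 0")
    case True
    have "(B1 g z - B1 (x n) z)\<^sup>2 \<le> V.dist2 g (x n) * B1 z z"
      using V.Cauchy_Schwarz_diff[OF g x] rel_mem[OF z] by blast
    then show ?thesis using True by simp
  next
    case False
    have zV: "z \<in> V" using rel_mem[OF z] by simp
    have pos: "B1 z z > 0" using False V.B_nonneg[OF zV] by simp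
    define a where "a = B1 g z - B1 (x n) z"
    define c where "c = a / B1 z z"
    have "rel (p1 (x n) (s1 c z)) (p2 (y n) (s2 c w))"
      by (intro span_rel.plus span_rel.smult xy z)
    then have "d \<le> V.dist2 g (p1 (x n) (s1 c z))" by (rule d_le)
    also have "\<dots> = V.dist2 g (x n) - 2 * c * a + c\<^sup>2 * B1 z z"
      using g x zV V.B_commute[OF zV x, of n]
      by (simp add: V.dist2_def V.B_simps a_def power2_eq_square algebra_simps)
    also have "\<dots> = V.dist2 g (x n) - a\<^sup>2 / B1 z z"
      using pos by (simp add: c_def power2_eq_square field_simps)
    finally have "a\<^sup>2 / B1 z z \<le> inverse (Suc n)" using less[of n] by simp
    then show ?thesis using pos by (simp add: a_def pos_divide_le_eq)
  qed
  \<comment> \<open>The midpoint \<open>?z\<close> lies in the span, so its squared distance from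
    \<open>g\<close> is at least \<open>d\<close>. In the parallelogram identity the multiples of
    \<open>d\<close> cancel and only the two excesses remain.\<close>
  have cauchy: "W.dist2 (y m) (y n) \<le> 2 * inverse (Suc m) + 2 * inverse (Suc n)" for m n
  proof -
    let ?z = "s1 (1/2) (p1 (x m) (x n))"
    have "rel ?z (s2 (1/2) (p2 (y m) (y n)))"
      by (intro span_rel.plus span_rel.smult xy)
    then have "d \<le> V.dist2 g ?z" by (rule d_le)
    moreover have "V.dist2 (x m) (x n) =
        2 * V.dist2 g (x m) + 2 * V.dist2 g (x n) - 4 * V.dist2 g ?z"
      using g x V.B_commute[OF x x, of m n]
      by (simp add: V.dist2_def V.B_simps algebra_simps)
    ultimately show ?thesis
      using less[of m] less[of n] rel_dist2[OF xy xy, of m n] by linarith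
  qed
  have "\<exists>h\<in>W. (\<lambda>n. W.dist2 (y n) h) \<longlonglongrightarrow> 0"
  proof (rule W.B_complete[OF y])
    fix e :: real assume "0 < e"
    then obtain N where N: "inverse (Suc N) < e / 4"
      using reals_Archimedean[of "e / 4"] by auto
    have inv: "inverse (real (Suc m)) \<le> inverse (Suc N)" if "N \<le> m" for m
      using that by (simp add: divide_simps)
    show "\<exists>N. \<forall>m\<ge>N. \<forall>n\<ge>N. W.dist2 (y m) (y n) < e"
    proof (intro exI allI impI)
      fix m n assume "N \<le> m" "N \<le> n"
      then show "W.dist2 (y m) (y n) < e"
        using cauchy[of m n] inv[of m] inv[of n] N by linarith
    qed
  qed
  then obtain h where h: "h \<in> W" and lim: "(\<lambda>n. W.dist2 (y n) h) \<longlonglongrightarrow> 0" by auto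
  note tB = W.tendsto_B[OF y h _ lim]
  \<comment> \<open>The numbers \<open>B1 (x n) (\<phi> t)\<close> and
    \<open>B2 (y n) (\<psi> t)\<close> coincide; \<open>near_orth\<close> gives the limit of the
    former, convergence of \<open>y n\<close> to \<open>h\<close> that of the latter.\<close>
  have rep: "B2 h (\<psi> t) = B1 g (\<phi> t)" if t: "t \<in> A" for t
  proof -
    have "(\<lambda>n. inverse (real (Suc n)) * B1 (\<phi> t) (\<phi> t)) \<longlonglongrightarrow> 0"
      using tendsto_mult_right[OF LIMSEQ_inverse_real_of_nat] by force
    then have "(\<lambda>n. (B1 g (\<phi> t) - B1 (x n) (\<phi> t))\<^sup>2) \<longlonglongrightarrow> 0"
      by (rule tendsto_sandwich[OF _ _ tendsto_const, rotated 2])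
         (intro always_eventually allI zero_le_power2 near_orth[OF span_rel.base[OF t]])+
    then have "(\<lambda>n. B1 g (\<phi> t) - B1 (x n) (\<phi> t)) \<longlonglongrightarrow> 0"
      using tendsto_real_sqrt by (fastforce simp: tendsto_rabs_zero_iff)
    then have "(\<lambda>n. B1 (x n) (\<phi> t)) \<longlonglongrightarrow> B1 g (\<phi> t)"
      using tendsto_diff[OF tendsto_const[of "B1 g (\<phi> t)"]] by force
    then show ?thesis
      using tB[OF \<psi>[OF t]] LIMSEQ_unique by (simp add: rel_B_base[OF xy t])
  qed
  have rep_rel: "B2 h w = B1 g z" if "rel z w" for z w
    using that
  proof (induction rule: span_rel.induct)
    case (plus x1 y1 x2 y2)
    then show ?case using rel_mem[OF plus.hyps(1)] rel_mem[OF plus.hyps(2)] g h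
      by (simp add: V.B_plus_right W.B_plus_right)
  next
    case (smult x1 y1 c)
    then show ?case using rel_mem[OF smult.hyps(1)] g h
      by (simp add: V.B_smult_right W.B_smult_right)
  qed (simp add: rep)
  \<comment> \<open>Cauchy-Schwarz for \<open>g\<close> and \<open>x n\<close>, rewritten in terms
    of \<open>h\<close> and the partners. Its limit bounds the square of \<open>B2 h h\<close> by
    \<open>B1 g g * B2 h h\<close>, and one factor cancels.\<close>
  have "(B2 h (y n))\<^sup>2 \<le> B1 g g * B2 (y n) (y n)" for n
    using V.Cauchy_Schwarz[OF g x, of n] by (simp add: rep_rel[OF xy] rel_B[OF xy xy])
  moreover have lim1: "(\<lambda>n. B2 h (y n)) \<longlonglongrightarrow> B2 h h"
    using tB[OF h] W.B_commute[OF h y] by simp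
  moreover have "(\<lambda>n. B2 (y n) (y n)) \<longlonglongrightarrow> B2 h h"
  proof -
    have "(\<lambda>n. W.dist2 (y n) h - B2 h h + 2 * B2 h (y n)) \<longlonglongrightarrow> 0 - B2 h h + 2 * B2 h h"
      by (intro tendsto_intros lim lim1)
    then show ?thesis using W.B_commute[OF h y] by (simp add: W.dist2_def)
  qed
  ultimately have "(B2 h h)\<^sup>2 \<le> B1 g g * B2 h h"
    by (intro LIMSEQ_le[of "\<lambda>n. (B2 h (y n))\<^sup>2" _ "\<lambda>n. B1 g g * B2 (y n) (y n)"] tendsto_intros) auto
  then have le: "B2 h h \<le> B1 g g"
    using W.B_nonneg[OF h] V.B_nonneg[OF g]
    by (cases "B2 h h = 0") (auto simp: power2_eq_square)
  \<comment> \<open>As a limit of span elements, \<open>h\<close> is orthogonal to whatever is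
    orthogonal to the family \<open>\<psi>\<close>.\<close>
  have "B2 h n = 0" if "n \<in> W" "\<And>t. t \<in> A \<Longrightarrow> B2 n (\<psi> t) = 0" for n
    using tB[OF that(1)] orthogonal_rel[OF that xy] W.B_commute[OF y that(1)]
    by (simp add: LIMSEQ_const_iff)
  then show thesis using that h rep le by blast
qed

end

section \<open>Completeness of the space of square-integrable functions\<close>

definition square_integrable :: "'x measure \<Rightarrow> ('x \<Rightarrow> real) set" where
  "square_integrable N = {g \<in> borel_measurable N. integrable N (\<lambda>x. (g x)\<^sup>2)}"

abbreviation L2_ip :: "'x measure \<Rightarrow> ('x \<Rightarrow> real) \<Rightarrow> ('x \<Rightarrow> real) \<Rightarrow> real" where
  "L2_ip N g h \<equiv> LINT x|N. g x * h x"

lemma square_integrable_measurable [measurable_dest]: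
  "g \<in> square_integrable N \<Longrightarrow> g \<in> borel_measurable N"
  by (simp add: square_integrable_def)

lemma square_integrable_mult:
  assumes "g \<in> square_integrable N" "h \<in> square_integrable N"
  shows "integrable N (\<lambda>x. g x * h x)"
proof (rule Bochner_Integration.integrable_bound)
  show "integrable N (\<lambda>x. (g x)\<^sup>2 + (h x)\<^sup>2)"
    using assms by (auto simp: square_integrable_def)
  have "\<bar>a * b\<bar> \<le> a\<^sup>2 + b\<^sup>2" for a b :: real
  proof -
    have "2 * (\<bar>a\<bar> * \<bar>b\<bar>) \<le> \<bar>a\<bar>\<^sup>2 + \<bar>b\<bar>\<^sup>2"
      using zero_le_power2[of "\<bar>a\<bar> - \<bar>b\<bar>"] by (simp add: power2_eq_square algebra_simps)
    moreover have "0 \<le> \<bar>a\<bar> * \<bar>b\<bar>" by simp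
    ultimately show ?thesis unfolding abs_mult power2_abs by linarith
  qed
  then show "AE x in N. norm (g x * h x) \<le> norm ((g x)\<^sup>2 + (h x)\<^sup>2)"
    by simp
qed (use assms in \<open>auto simp: square_integrable_def\<close>)

lemma square_integrable_add:
  assumes g: "g \<in> square_integrable N" and h: "h \<in> square_integrable N"
  shows "(\<lambda>x. g x + h x) \<in> square_integrable N"
  using g h square_integrable_mult[OF g h]
  by (auto simp: square_integrable_def power2_sum mult.assoc)

lemma square_integrable_scale:
  "g \<in> square_integrable N \<Longrightarrow> (\<lambda>x. c * g x) \<in> square_integrable N"
  by (auto simp: square_integrable_def power_mult_distrib)

lemma square_integrable_diff:
  assumes "g \<in> square_integrable N" "h \<in> square_integrable N"
  shows "(\<lambda>x. g x - h x) \<in> square_integrable N"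
  using square_integrable_add[OF assms(1) square_integrable_scale[OF assms(2), of "-1"]] by simp

interpretation L2: semi_inner_space "square_integrable N" "\<lambda>g h x. g x + h x"
  "\<lambda>c g x. c * g x" "L2_ip N" for N :: "'x measure"
proof
  fix g h k :: "'x \<Rightarrow> real"
  assume "g \<in> square_integrable N" "h \<in> square_integrable N" "k \<in> square_integrable N"
  then show "L2_ip N (\<lambda>x. g x + h x) k = L2_ip N g k + L2_ip N h k"
    by (simp add: distrib_right square_integrable_mult)
next
  fix g h :: "'x \<Rightarrow> real" and c
  show "L2_ip N (\<lambda>x. c * g x) h = c * L2_ip N g h"
    by (simp add: mult.assoc)
qed (auto intro: square_integrable_add square_integrable_scale simp: mult.commute)

lemma L2_dist2:
  assumes g: "g \<in> square_integrable N" and h: "h \<in> square_integrable N"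
  shows "L2.dist2 N g h = (LINT x|N. (g x - h x)\<^sup>2)"
  using L2.dist2_eq[OF g h] by (simp add: power2_eq_square)

lemma nn_integral_square_diff:
  assumes g: "g \<in> square_integrable N" and h: "h \<in> square_integrable N"
  shows "(\<integral>\<^sup>+x. ennreal ((g x - h x)\<^sup>2) \<partial>N) = ennreal (L2.dist2 N g h)"
  using square_integrable_diff[OF g h]
  by (simp add: L2_dist2[OF g h] nn_integral_eq_integral square_integrable_def)

text \<open>The summands are eventually below 1, so the increments are at most
  \<open>(1/2) ^ k\<close> in absolute value and the telescoping series converges.\<close>

lemma convergent_if_weighted_square_summable:
  fixes f :: "nat \<Rightarrow> real"
  assumes "summable (\<lambda>k. 4 ^ k * (f (Suc k) - f k)\<^sup>2)"
  shows "convergent f"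
proof -
  have "(\<lambda>k. 4 ^ k * (f (Suc k) - f k)\<^sup>2) \<longlonglongrightarrow> 0"
    using assms by (rule summable_LIMSEQ_zero)
  then have "\<forall>\<^sub>F k in sequentially. 4 ^ k * (f (Suc k) - f k)\<^sup>2 < 1"
    by (rule order_tendstoD) simp
  then have ev: "\<forall>\<^sub>F k in sequentially. norm (f (Suc k) - f k) \<le> (1/2) ^ k"
  proof eventually_elim
    case (elim k)
    have "(4::real) ^ k = (2 ^ k)\<^sup>2" by (simp flip: power_mult add: power_mult mult.commute[of k])
    then have "(2 ^ k * \<bar>f (Suc k) - f k\<bar>)\<^sup>2 \<le> 1\<^sup>2"
      using elim by (simp add: power_mult_distrib)
    then have "2 ^ k * \<bar>f (Suc k) - f k\<bar> \<le> 1"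
      by (rule power2_le_imp_le) simp
    then show ?case by (simp add: power_one_over field_simps)
  qed
  have "summable (\<lambda>k. f (Suc k) - f k)"
    by (rule summable_comparison_test_ev[OF ev]) simp
  then have "convergent (\<lambda>n. \<Sum>k<n. f (Suc k) - f k)"
    by (simp add: summable_iff_convergent)
  then have "convergent (\<lambda>n. f n - f 0)"
    by (simp add: sum_lessThan_telescope)
  then show ?thesis
    by (simp add: convergent_diff_const_right_iff)
qed

lemma fast_Cauchy_subsequence:
  fixes d :: "nat \<Rightarrow> nat \<Rightarrow> real"
  assumes "\<And>e. 0 < e \<Longrightarrow> \<exists>N. \<forall>m\<ge>N. \<forall>n\<ge>N. d m n < e" and "\<And>k. 0 < \<epsilon> k"
  obtains r where "strict_mono r" "\<And>k. d (r (Suc k)) (r k) < \<epsilon> k"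
proof -
  have "\<forall>k. \<exists>N. \<forall>m\<ge>N. \<forall>n\<ge>N. d m n < \<epsilon> k" using assms by blast
  then obtain n0 where n0: "\<And>k m n. m \<ge> n0 k \<Longrightarrow> n \<ge> n0 k \<Longrightarrow> d m n < \<epsilon> k" by metis
  \<comment> \<open>The maximum secures strict growth and also places \<open>r k\<close> beyond the
    threshold belonging to \<open>\<epsilon> k\<close>.\<close>
  define r where "r = rec_nat (n0 0) (\<lambda>k x. max (Suc x) (n0 (Suc k)))"
  have r_Suc: "r (Suc k) = max (Suc (r k)) (n0 (Suc k))" for k by (simp add: r_def)
  have ge: "n0 k \<le> r k" for k by (cases k) (auto simp: r_def)
  have mono: "strict_mono r" by (simp add: strict_mono_Suc_iff r_Suc less_max_iff_disj)
  have "d (r (Suc k)) (r k) < \<epsilon> k" for k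
    using ge[of k] mono by (intro n0) (auto simp: r_Suc)
  with mono show thesis using that by blast
qed

text \<open>Riesz--Fischer: along a subsequence with squared increments below \<open>8\<^sup>-\<^sup>k\<close> the weighted
  series \<open>\<Sum>k. 4\<^sup>k (S\<^sub>k\<^sub>+\<^sub>1 - S\<^sub>k)\<^sup>2\<close> is integrable, which forces pointwise convergence a.e.\<close>

lemma L2_complete:
  assumes S: "\<And>n::nat. S n \<in> square_integrable N"
    and cauchy: "\<And>e. 0 < e \<Longrightarrow> \<exists>n0. \<forall>m\<ge>n0. \<forall>n\<ge>n0. L2.dist2 N (S m) (S n) < e"
  shows "\<exists>f\<in>square_integrable N. (\<lambda>n. L2.dist2 N (S n) f) \<longlonglongrightarrow> 0"
proof -
  obtain r where r: "strict_mono r"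
    and fast: "\<And>k. L2.dist2 N (S (r (Suc k))) (S (r k)) < (1/8) ^ k"
    using fast_Cauchy_subsequence[OF cauchy, of "\<lambda>k. (1/8) ^ k"] by auto
  have meas[measurable]: "S n \<in> borel_measurable N" for n
    using S by (rule square_integrable_measurable)
  define w where "w k x = 4 ^ k * (S (r (Suc k)) x - S (r k) x)\<^sup>2" for k x
  have [measurable]: "w k \<in> borel_measurable N" for k unfolding w_def by measurable
  have w0: "0 \<le> w k x" for k x by (simp add: w_def)
  have "(\<integral>\<^sup>+x. (\<Sum>k. ennreal (w k x)) \<partial>N) = (\<Sum>k. \<integral>\<^sup>+x. ennreal (w k x) \<partial>N)"
    by (rule nn_integral_suminf) simp
  also have "\<dots> \<le> (\<Sum>k. ennreal ((1/2) ^ k))"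
  proof (intro suminf_le summableI)
    fix k
    have "(\<integral>\<^sup>+x. ennreal (w k x) \<partial>N)
        = ennreal (4 ^ k) * (\<integral>\<^sup>+x. ennreal ((S (r (Suc k)) x - S (r k) x)\<^sup>2) \<partial>N)"
      unfolding w_def by (subst nn_integral_cmult[symmetric]) (auto simp: ennreal_mult)
    also have "\<dots> = ennreal (4 ^ k * L2.dist2 N (S (r (Suc k))) (S (r k)))"
      by (subst nn_integral_square_diff[OF S S]) (simp add: ennreal_mult L2.dist2_nonneg S)
    also have "\<dots> \<le> ennreal (4 ^ k * (1/8) ^ k)"
      using fast[of k] by (intro ennreal_leI mult_left_mono) auto
    also have "(4::real) ^ k * (1/8) ^ k = (1/2) ^ k" by (simp flip: power_mult_distrib)
    finally show "(\<integral>\<^sup>+x. ennreal (w k x) \<partial>N) \<le> ennreal ((1/2) ^ k)" .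
  qed
  also have "\<dots> = ennreal 2"
    by (subst suminf_ennreal2) (auto simp: suminf_geometric)
  finally have "(\<integral>\<^sup>+x. (\<Sum>k. ennreal (w k x)) \<partial>N) \<noteq> \<infinity>"
    by (auto simp: top_unique)
  then have "AE x in N. (\<Sum>k. ennreal (w k x)) \<noteq> \<infinity>"
    by (intro nn_integral_PInf_AE) auto
  then have conv: "AE x in N. convergent (\<lambda>k. S (r k) x)"
  proof eventually_elim
    case (elim x)
    then have "summable (\<lambda>k. w k x)"
      by (intro summable_suminf_not_top) (auto simp: w0)
    then show ?case
      by (intro convergent_if_weighted_square_summable) (simp add: w_def)
  qed
  \<comment> \<open>Where the subsequence diverges, \<open>lim\<close> takes a default value; this
    happens only on a null set.\<close>
  define f where "f x = lim (\<lambda>k. S (r k) x)" for x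
  have [measurable]: "f \<in> borel_measurable N" unfolding f_def by measurable
  \<comment> \<open>Fatou's lemma along the subsequence: a bound on the distances from
    \<open>S n\<close> to all late \<open>S m\<close> persists for the limit
    \<open>f\<close>.\<close>
  have bound: "(\<integral>\<^sup>+x. ennreal ((S n x - f x)\<^sup>2) \<partial>N) \<le> ennreal e"
    if n: "\<And>m. m \<ge> n0 \<Longrightarrow> L2.dist2 N (S n) (S m) \<le> e" for n n0 e
  proof -
    have "(\<integral>\<^sup>+x. ennreal ((S n x - f x)\<^sup>2) \<partial>N)
        = (\<integral>\<^sup>+x. liminf (\<lambda>k. ennreal ((S n x - S (r k) x)\<^sup>2)) \<partial>N)"
    proof (rule nn_integral_cong_AE, use conv in eventually_elim)
      case (elim x)
      then have "(\<lambda>k. S (r k) x) \<longlonglongrightarrow> f x" by (simp add: f_def convergent_LIMSEQ_iff)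
      then have "(\<lambda>k. ennreal ((S n x - S (r k) x)\<^sup>2)) \<longlonglongrightarrow> ennreal ((S n x - f x)\<^sup>2)"
        by (intro tendsto_ennrealI tendsto_intros)
      then show ?case using lim_imp_Liminf[OF sequentially_bot] by metis
    qed
    also have "\<dots> \<le> liminf (\<lambda>k. \<integral>\<^sup>+x. ennreal ((S n x - S (r k) x)\<^sup>2) \<partial>N)"
      by (rule nn_integral_liminf) simp
    also have "\<dots> = liminf (\<lambda>k. ennreal (L2.dist2 N (S n) (S (r k))))"
      by (simp add: nn_integral_square_diff S)
    also have "\<dots> \<le> ennreal e"
    proof (rule Liminf_le)
      have "\<forall>\<^sub>F k in sequentially. n0 \<le> r k"
        using filterlim_subseq[OF r] by (auto simp: filterlim_at_top)
      then show "\<forall>\<^sub>F k in sequentially. ennreal (L2.dist2 N (S n) (S (r k))) \<le> ennreal e"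
        by eventually_elim (intro ennreal_leI n)
    qed simp
    finally show ?thesis .
  qed
  have sq: "(\<lambda>x. S n x - f x) \<in> square_integrable N"
    if "\<And>m. m \<ge> n0 \<Longrightarrow> L2.dist2 N (S n) (S m) \<le> e" for n n0 e
    using bound[OF that] unfolding square_integrable_def
    by (auto intro!: integrableI_nonneg simp: top_unique less_top[symmetric])
  obtain n1 where n1: "\<And>m n. m \<ge> n1 \<Longrightarrow> n \<ge> n1 \<Longrightarrow> L2.dist2 N (S m) (S n) < 1"
    using cauchy[of 1] by auto
  \<comment> \<open>\<open>f\<close> is recovered as \<open>S n1 - (S n1 - f)\<close>, a difference
    of two square-integrable functions.\<close>
  have f: "f \<in> square_integrable N"
    using square_integrable_diff[OF S[of n1] sq[of n1 n1 1]] n1 by (force intro: less_imp_le)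
  have "(\<lambda>n. L2.dist2 N (S n) f) \<longlonglongrightarrow> 0"
  proof (rule LIMSEQ_I)
    fix e :: real assume "0 < e"
    then obtain n0 where n0: "\<And>m n. m \<ge> n0 \<Longrightarrow> n \<ge> n0 \<Longrightarrow> L2.dist2 N (S m) (S n) < e / 2"
      using cauchy[of "e / 2"] by auto
    show "\<exists>n0. \<forall>n\<ge>n0. norm (L2.dist2 N (S n) f - 0) < e"
    proof (intro exI allI impI)
      fix n assume "n0 \<le> n"
      then have "ennreal (L2.dist2 N (S n) f) \<le> ennreal (e / 2)"
        using bound[of n0 n "e / 2"] n0 by (auto simp: nn_integral_square_diff S f less_imp_le)
      then show "norm (L2.dist2 N (S n) f - 0) < e"
        using \<open>0 < e\<close> L2.dist2_nonneg[OF S f, of n] by simp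
    qed
  qed
  with f show ?thesis by blast
qed

interpretation L2: semi_hilbert_space "square_integrable N" "\<lambda>g h x. g x + h x"
  "\<lambda>c g x. c * g x" "L2_ip N" for N :: "'x measure"
  by unfold_locales (rule L2_complete)

section \<open>Kernels given by square-integrable features\<close>

context hilbert_function_space
begin

text \<open>\<open>ip_pos\<close> speaks of nonzero functions; the zero function is its own multiple
  by 0.\<close>

lemma ip_nonneg:
  assumes "F \<in> H"
  shows "0 \<le> ip F F"
proof (cases "F = (\<lambda>x\<in>A. 0)")
  case True
  then show ?thesis using ip_scale[OF assms assms, of 0] by simp
qed (use ip_pos[OF assms] in simp)

sublocale semi_inner_space H "\<lambda>F G. \<lambda>x\<in>A. F x + G x" "\<lambda>c F. \<lambda>x\<in>A. c * F x" ip
  by unfold_locales (rule add scale ip_commute ip_add ip_scale ip_nonneg; assumption)+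

lemma fnorm_diff:
  assumes "F \<in> H" "G \<in> H"
  shows "fnorm ip (\<lambda>x\<in>A. F x - G x) = sqrt (dist2 F G)"
proof -
  have "(\<lambda>x\<in>A. F x + (\<lambda>x\<in>A. - 1 * G x) x) = (\<lambda>x\<in>A. F x - G x)" by auto
  then show ?thesis using dist2_eq[OF assms] by (simp add: fnorm_def)
qed

sublocale semi_hilbert_space H "\<lambda>F G. \<lambda>x\<in>A. F x + G x" "\<lambda>c F. \<lambda>x\<in>A. c * F x" ip
proof
  fix S :: "nat \<Rightarrow> _" assume S: "\<And>n. S n \<in> H"
    and cauchy: "\<And>e. 0 < e \<Longrightarrow> \<exists>N. \<forall>m\<ge>N. \<forall>n\<ge>N. dist2 (S m) (S n) < e"
  have "\<exists>F\<in>H. (\<lambda>n. fnorm ip (\<lambda>x\<in>A. S n x - F x)) \<longlonglongrightarrow> 0"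
  proof (rule complete[OF S])
    fix e :: real assume "0 < e"
    then obtain N where N: "\<And>m n. m \<ge> N \<Longrightarrow> n \<ge> N \<Longrightarrow> dist2 (S m) (S n) < e\<^sup>2"
      using cauchy[of "e\<^sup>2"] by auto
    have "sqrt (dist2 (S m) (S n)) < e" if "m \<ge> N" "n \<ge> N" for m n
      using real_sqrt_less_mono[OF N[OF that]] \<open>0 < e\<close> by simp
    then show "\<exists>N. \<forall>m\<ge>N. \<forall>n\<ge>N. fnorm ip (\<lambda>x\<in>A. S m x - S n x) < e"
      unfolding fnorm_diff[OF S S] by blast
  qed
  then obtain F where F: "F \<in> H" and "(\<lambda>n. sqrt (dist2 (S n) F)) \<longlonglongrightarrow> 0"
    by (auto simp: fnorm_diff S)
  from tendsto_power[OF this(2), of 2] show "\<exists>F\<in>H. (\<lambda>n. dist2 (S n) F) \<longlonglongrightarrow> 0"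
    using F S by (auto simp: dist2_nonneg)
qed

end

section \<open>Comparison of a given reproducing kernel Hilbert space with the features\<close>

locale L2_feature_map =
  fixes N :: "'x measure" and A :: "'b set" and \<phi> :: "'b \<Rightarrow> 'x \<Rightarrow> real"
    and K :: "'b \<Rightarrow> 'b \<Rightarrow> real"
  assumes nonempty: "A \<noteq> {}"
    and feature: "t \<in> A \<Longrightarrow> \<phi> t \<in> square_integrable N"
    and kernel_eq: "s \<in> A \<Longrightarrow> t \<in> A \<Longrightarrow> K s t = L2_ip N (\<phi> s) (\<phi> t)"
begin

text \<open>Transfer \<open>g\<close> into \<open>H\<close>, matching features with kernel
  functions. By the reproducing property the inner products of the transferred \<open>G\<close> with
  kernel functions are its point values, so \<open>G\<close> is \<open>F\<close>.\<close>

lemma rkhs_mem_of_L2: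
  assumes "rkhs A K H ip" "g \<in> square_integrable N"
    and F: "F \<in> extensional A" "\<And>t. t \<in> A \<Longrightarrow> F t = L2_ip N g (\<phi> t)"
  shows "F \<in> H" "ip F F \<le> L2_ip N g g"
proof -
  interpret H: rkhs A K H ip by fact
  interpret gram_pair "square_integrable N" "\<lambda>g h x. g x + h x" "\<lambda>c g x. c * g x" "L2_ip N"
    H "\<lambda>F G. \<lambda>x\<in>A. F x + G x" "\<lambda>c F. \<lambda>x\<in>A. c * F x" ip A \<phi> "\<lambda>t. \<lambda>s\<in>A. K s t"
  proof
    fix s t assume "s \<in> A" "t \<in> A"
    then show "L2_ip N (\<phi> s) (\<phi> t) = ip (\<lambda>r\<in>A. K r s) (\<lambda>r\<in>A. K r t)"
      using H.reproducing[OF H.kernel_mem[of s], of t]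
      by (simp add: kernel_eq mult.commute)
  qed (simp_all add: nonempty feature H.kernel_mem)
  obtain G where G: "G \<in> H" "\<And>t. t \<in> A \<Longrightarrow> ip G (\<lambda>s\<in>A. K s t) = L2_ip N g (\<phi> t)"
    "ip G G \<le> L2_ip N g g"
    by (rule transfer[OF assms(2)]) blast
  have "G t = F t" if "t \<in> A" for t
    unfolding H.reproducing[OF G(1) that] G(2)[OF that] F(2)[OF that] ..
  then have "G = F"
    using F(1) G(1) H.carrier by (intro extensionalityI[of G A F]) auto
  then show "F \<in> H" "ip F F \<le> L2_ip N g g" using G by auto
qed

text \<open>The opposite transfer: the inner products of \<open>F\<close> with kernel functions,
  which are its point values, become inner products of some \<open>g\<close> with the
  features.\<close>

lemma L2_of_rkhs_mem:
  assumes "rkhs A K H ip" "F \<in> H"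
  obtains g where "g \<in> square_integrable N" "\<And>t. t \<in> A \<Longrightarrow> F t = L2_ip N g (\<phi> t)"
    "L2_ip N g g \<le> ip F F"
proof -
  interpret H: rkhs A K H ip by fact
  interpret gram_pair H "\<lambda>F G. \<lambda>x\<in>A. F x + G x" "\<lambda>c F. \<lambda>x\<in>A. c * F x" ip
    "square_integrable N" "\<lambda>g h x. g x + h x" "\<lambda>c g x. c * g x" "L2_ip N"
    A "\<lambda>t. \<lambda>s\<in>A. K s t" \<phi>
  proof
    fix s t assume "s \<in> A" "t \<in> A"
    then show "ip (\<lambda>r\<in>A. K r s) (\<lambda>r\<in>A. K r t) = L2_ip N (\<phi> s) (\<phi> t)"
      using H.reproducing[OF H.kernel_mem[of s], of t]
      by (simp add: kernel_eq mult.commute)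
  qed (simp_all add: nonempty feature H.kernel_mem)
  obtain g where g: "g \<in> square_integrable N"
    "\<And>t. t \<in> A \<Longrightarrow> L2_ip N g (\<phi> t) = ip F (\<lambda>s\<in>A. K s t)" "L2_ip N g g \<le> ip F F"
    by (rule transfer[OF assms(2)]) blast
  show thesis
    by (rule that[OF g(1) _ g(3)]) (rule trans[OF H.reproducing[OF assms(2)] g(2)[symmetric]])
qed

section \<open>Existence: the image of the closed span of the features\<close>

definition null_space :: "('x \<Rightarrow> real) set" where
  "null_space = {n \<in> square_integrable N. \<forall>t\<in>A. L2_ip N n (\<phi> t) = 0}"

text \<open>The closed linear span encoded as a double orthogonal complement, so that linearity and
  closedness under limits come directly from the inner product.\<close>

definition closed_span :: "('x \<Rightarrow> real) set" where
  "closed_span = {g \<in> square_integrable N. \<forall>n\<in>null_space. L2_ip N g n = 0}"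

definition eval_map :: "('x \<Rightarrow> real) \<Rightarrow> 'b \<Rightarrow> real" where
  "eval_map g = (\<lambda>t\<in>A. L2_ip N g (\<phi> t))"

text \<open>A preimage in \<open>closed_span\<close> is determined only up to seminorm zero, hence
  the choice. Without a preimage the value is arbitrary.\<close>

definition representative :: "('b \<Rightarrow> real) \<Rightarrow> 'x \<Rightarrow> real" where
  "representative F = (SOME g. g \<in> closed_span \<and> eval_map g = F)"

definition eval_ip :: "('b \<Rightarrow> real) \<Rightarrow> ('b \<Rightarrow> real) \<Rightarrow> real" where
  "eval_ip F G = L2_ip N (representative F) (representative G)"

lemma closed_span_L2: "g \<in> closed_span \<Longrightarrow> g \<in> square_integrable N"
  by (simp add: closed_span_def)

lemma feature_closed_span: "t \<in> A \<Longrightarrow> \<phi> t \<in> closed_span"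
  by (simp add: closed_span_def null_space_def feature mult.commute)

lemma closed_span_add:
  assumes "g \<in> closed_span" "h \<in> closed_span"
  shows "(\<lambda>x. g x + h x) \<in> closed_span"
  using assms by (auto simp: closed_span_def null_space_def square_integrable_add L2.B_plus)

lemma closed_span_scale: "g \<in> closed_span \<Longrightarrow> (\<lambda>x. c * g x) \<in> closed_span"
  by (auto simp: closed_span_def null_space_def square_integrable_scale L2.B_smult)

lemma eval_map_add:
  assumes "g \<in> square_integrable N" "h \<in> square_integrable N"
  shows "eval_map (\<lambda>x. g x + h x) = (\<lambda>t\<in>A. eval_map g t + eval_map h t)"
  using assms by (auto simp: eval_map_def L2.B_plus feature)

lemma eval_map_scale: "eval_map (\<lambda>x. c * g x) = (\<lambda>t\<in>A. c * eval_map g t)"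
  by (auto simp: eval_map_def mult.assoc)

lemma representative:
  assumes "g \<in> closed_span"
  shows "representative (eval_map g) \<in> closed_span"
    "eval_map (representative (eval_map g)) = eval_map g"
  unfolding representative_def
  by (rule someI2[where P="\<lambda>h. h \<in> closed_span \<and> eval_map h = eval_map g"], use assms in auto)+

text \<open>The difference \<open>g - g'\<close> is orthogonal to all features, so it lies in
  \<open>null_space\<close>, to which \<open>h\<close> is orthogonal. This makes
  \<open>eval_ip\<close> independent of the chosen representatives.\<close>

lemma L2_ip_eval_map_cong:
  assumes "g \<in> square_integrable N" "g' \<in> square_integrable N" "eval_map g = eval_map g'"
    "h \<in> closed_span"
  shows "L2_ip N g h = L2_ip N g' h"
proof -
  let ?n = "\<lambda>x. g x + (-1) * g' x"
  have n: "?n \<in> square_integrable N"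
    using square_integrable_diff[OF assms(1,2)] by simp
  have "L2_ip N ?n (\<phi> t) = 0" if "t \<in> A" for t
    using L2.B_plus[OF assms(1) square_integrable_scale[OF assms(2)] feature[OF that], of "-1"]
      fun_cong[OF assms(3), of t] that by (simp add: eval_map_def)
  then have "?n \<in> null_space" using n by (simp add: null_space_def)
  then have "L2_ip N h ?n = 0" using assms(4) by (simp add: closed_span_def)
  then have "L2_ip N ?n h = 0" by (simp add: mult.commute)
  then show ?thesis
    using L2.B_plus[OF assms(1) square_integrable_scale[OF assms(2)] closed_span_L2[OF assms(4)], of "-1"]
    by simp
qed

lemma eval_ip:
  assumes g: "g \<in> closed_span" and h: "h \<in> closed_span"
  shows "eval_ip (eval_map g) (eval_map h) = L2_ip N g h"
proof -
  note rg = representative[OF g] and rh = representative[OF h]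
  have "eval_ip (eval_map g) (eval_map h) = L2_ip N g (representative (eval_map h))"
    unfolding eval_ip_def
    by (rule L2_ip_eval_map_cong) (use rg rh g closed_span_L2 in auto)
  also have "\<dots> = L2_ip N (representative (eval_map h)) g" by (simp add: mult.commute)
  also have "\<dots> = L2_ip N h g"
    by (rule L2_ip_eval_map_cong) (use rh g h closed_span_L2 in auto)
  finally show ?thesis by (simp add: mult.commute)
qed

lemma eval_map_sum:
  assumes "g \<in> closed_span" "h \<in> closed_span"
  shows "(\<lambda>t\<in>A. eval_map g t + c * eval_map h t) = eval_map (\<lambda>x. g x + c * h x)"
  using assms
  by (auto simp: eval_map_add eval_map_scale closed_span_L2 square_integrable_scale)

lemma eval_map_diff:
  assumes "g \<in> closed_span" "h \<in> closed_span"
  shows "fnorm eval_ip (\<lambda>t\<in>A. eval_map g t - eval_map h t) = sqrt (L2.dist2 N g h)"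
  using eval_ip[OF closed_span_add[OF assms(1) closed_span_scale[OF assms(2)]]
      closed_span_add[OF assms(1) closed_span_scale[OF assms(2)]], of "-1" "-1"]
    eval_map_sum[OF assms, of "-1"] L2_dist2[OF assms[THEN closed_span_L2]]
  by (simp add: fnorm_def power2_eq_square)

text \<open>Since \<open>eval_map\<close> is isometric on \<open>closed_span\<close>, preimages form
  a Cauchy sequence. Their limit stays in \<open>closed_span\<close> because orthogonality to
  \<open>null_space\<close> passes to limits.\<close>

lemma eval_complete:
  assumes S: "\<And>n::nat. S n \<in> eval_map ` closed_span"
    and cauchy: "\<And>e. 0 < e \<Longrightarrow> \<exists>N. \<forall>m\<ge>N. \<forall>n\<ge>N. fnorm eval_ip (\<lambda>x\<in>A. S m x - S n x) < e"
  shows "\<exists>F\<in>eval_map ` closed_span. (\<lambda>n. fnorm eval_ip (\<lambda>x\<in>A. S n x - F x)) \<longlonglongrightarrow> 0"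
proof -
  obtain s where s: "\<And>n. s n \<in> closed_span" and Ss: "\<And>n. S n = eval_map (s n)"
    using S unfolding image_iff by metis
  note s2 = closed_span_L2[OF s]
  have "\<exists>f\<in>square_integrable N. (\<lambda>n. L2.dist2 N (s n) f) \<longlonglongrightarrow> 0"
  proof (rule L2_complete[OF s2])
    fix e :: real assume "0 < e"
    then have "\<exists>n0. \<forall>m\<ge>n0. \<forall>n\<ge>n0. fnorm eval_ip (\<lambda>x\<in>A. S m x - S n x) < sqrt e"
      by (intro cauchy) simp
    then show "\<exists>n0. \<forall>m\<ge>n0. \<forall>n\<ge>n0. L2.dist2 N (s m) (s n) < e"
      by (simp add: Ss eval_map_diff s)
  qed
  then obtain f where f: "f \<in> square_integrable N" and lim: "(\<lambda>n. L2.dist2 N (s n) f) \<longlonglongrightarrow> 0"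
    by auto
  have "L2_ip N f n = 0" if "n \<in> null_space" for n
  proof -
    have "n \<in> square_integrable N" using that by (simp add: null_space_def)
    from L2.tendsto_B[OF s2 f this lim] show ?thesis
      using s that by (simp add: closed_span_def LIMSEQ_const_iff)
  qed
  then have fs: "f \<in> closed_span" using f by (simp add: closed_span_def)
  have "(\<lambda>n. fnorm eval_ip (\<lambda>x\<in>A. S n x - eval_map f x)) \<longlonglongrightarrow> 0"
    using tendsto_real_sqrt[OF lim] by (simp add: Ss eval_map_diff s fs)
  then show ?thesis using fs by blast
qed

lemma feature_eval: "t \<in> A \<Longrightarrow> eval_map (\<phi> t) = (\<lambda>s\<in>A. K s t)"
  by (auto simp: eval_map_def kernel_eq mult.commute)

text \<open>The kernel functions are the images of the features, so the reproducing property is the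
  definition of \<open>eval_map\<close> read through the isometry.\<close>

lemma rkhs_eval: "rkhs A K (eval_map ` closed_span) eval_ip"
proof
  show "eval_map ` closed_span \<subseteq> extensional A" by (auto simp: eval_map_def)
  have "eval_map (\<lambda>x. 0) = (\<lambda>x\<in>A. 0)" by (simp add: eval_map_def)
  moreover have "(\<lambda>x. 0) \<in> closed_span" by (simp add: closed_span_def square_integrable_def)
  ultimately show "(\<lambda>x\<in>A. 0) \<in> eval_map ` closed_span" by (metis imageI)
next
  fix F assume "F \<in> eval_map ` closed_span" and F0: "F \<noteq> (\<lambda>x\<in>A. 0)"
  then obtain g where g: "g \<in> closed_span" and F: "F = eval_map g" by auto
  have g2: "g \<in> square_integrable N" using g by (rule closed_span_L2)
  \<comment> \<open>By Cauchy-Schwarz against the features, a \<open>g\<close> of norm zero would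
    have only zero evaluations.\<close>
  have "L2_ip N g g \<noteq> 0"
  proof
    assume "L2_ip N g g = 0"
    then have "L2_ip N g (\<phi> t) = 0" if "t \<in> A" for t
      using L2.Cauchy_Schwarz[OF g2 feature[OF that]] by simp
    then show False using F0 by (auto simp: F eval_map_def)
  qed
  then show "0 < eval_ip F F"
    using L2.B_nonneg[OF g2] unfolding F eval_ip[OF g g] by linarith
next
  fix t assume t: "t \<in> A"
  show "\<exists>C. \<forall>F\<in>eval_map ` closed_span. \<bar>F t\<bar> \<le> C * fnorm eval_ip F"
  proof (intro exI ballI)
    fix F assume "F \<in> eval_map ` closed_span"
    then obtain g where g: "g \<in> closed_span" and F: "F = eval_map g" by auto
    have "(F t)\<^sup>2 \<le> L2_ip N (\<phi> t) (\<phi> t) * L2_ip N g g"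
      using L2.Cauchy_Schwarz[OF closed_span_L2[OF g] feature[OF t]] t
      by (simp add: F eval_map_def mult.commute)
    then have "\<bar>F t\<bar> \<le> sqrt (L2_ip N (\<phi> t) (\<phi> t) * L2_ip N g g)"
      by (intro real_le_rsqrt) simp
    then show "\<bar>F t\<bar> \<le> sqrt (L2_ip N (\<phi> t) (\<phi> t)) * fnorm eval_ip F"
      by (simp only: fnorm_def F eval_ip[OF g g] real_sqrt_mult)
  qed
  show "(\<lambda>s\<in>A. K s t) \<in> eval_map ` closed_span"
    unfolding feature_eval[OF t, symmetric] using t by (intro imageI feature_closed_span)
  fix F assume "F \<in> eval_map ` closed_span"
  then obtain g where g: "g \<in> closed_span" and F: "F = eval_map g" by auto
  show "F t = eval_ip F (\<lambda>s\<in>A. K s t)"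
    unfolding F feature_eval[OF t, symmetric] eval_ip[OF g feature_closed_span[OF t]]
    using t by (simp add: eval_map_def)
next
  fix S :: "nat \<Rightarrow> _"
  assume "\<And>n. S n \<in> eval_map ` closed_span"
    "\<And>e. 0 < e \<Longrightarrow> \<exists>N. \<forall>m\<ge>N. \<forall>n\<ge>N. fnorm eval_ip (\<lambda>x\<in>A. S m x - S n x) < e"
  then show "\<exists>F\<in>eval_map ` closed_span. (\<lambda>n. fnorm eval_ip (\<lambda>x\<in>A. S n x - F x)) \<longlonglongrightarrow> 0"
    by (rule eval_complete)
next
  fix F G c assume "F \<in> eval_map ` closed_span" "G \<in> eval_map ` closed_span"
  then obtain g h where g: "g \<in> closed_span" "F = eval_map g" and h: "h \<in> closed_span" "G = eval_map h"
    by auto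
  note gh = closed_span_L2[OF g(1)] closed_span_L2[OF h(1)]
  have sum: "(\<lambda>x\<in>A. F x + G x) = eval_map (\<lambda>x. g x + h x)"
    using gh by (simp only: g(2) h(2) eval_map_add)
  have scale: "(\<lambda>x\<in>A. c * F x) = eval_map (\<lambda>x. c * g x)"
    by (simp only: g(2) eval_map_scale)
  show "(\<lambda>x\<in>A. F x + G x) \<in> eval_map ` closed_span"
    unfolding sum using g h by (intro imageI closed_span_add)
  show "(\<lambda>x\<in>A. c * F x) \<in> eval_map ` closed_span"
    unfolding scale using g by (intro imageI closed_span_scale)
  show "eval_ip F G = eval_ip G F"
    by (simp only: g(2) h(2) eval_ip[OF g(1) h(1)] eval_ip[OF h(1) g(1)] L2.B_commute[OF gh])
  show "eval_ip (\<lambda>x\<in>A. c * F x) G = c * eval_ip F G"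
    unfolding scale unfolding g(2) h(2)
    by (simp only: eval_ip closed_span_scale g(1) h(1) L2.B_smult gh)
  fix E assume "E \<in> eval_map ` closed_span"
  then obtain e where e: "e \<in> closed_span" "E = eval_map e" by auto
  show "eval_ip (\<lambda>x\<in>A. F x + G x) E = eval_ip F E + eval_ip G E"
    unfolding sum unfolding g(2) h(2) e(2)
    by (simp only: eval_ip closed_span_add g(1) h(1) e(1) L2.B_plus gh closed_span_L2)
qed

end

section \<open>Initial segments of the half-line\<close>

text \<open>The positive and negative parts of \<open>f\<close> are densities of finite measures
  with the same distribution function, hence of one measure. They agree almost everywhere, which
  forces both to vanish.\<close>

lemma AE_lborel_zero_if_integral_atMost_zero:
  fixes f :: "real \<Rightarrow> real"
  assumes f: "integrable lborel f"
    and zero: "\<And>a. (LINT x|lborel. indicator {..a} x * f x) = 0"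
  shows "AE x in lborel. f x = 0"
proof -
  have fm[measurable]: "f \<in> borel_measurable lborel" using f by auto
  \<comment> \<open>\<open>s\<close> is a sign: \<open>P 1\<close> has the positive part as density,
    \<open>P (-1)\<close> the negative part.\<close>
  define P where "P s = density lborel (\<lambda>x. ennreal (max 0 (s * f x)))" for s :: real
  have int: "integrable lborel (\<lambda>x. max 0 (s * f x))" for s
    using f by (intro integrable_max) auto
  have int_ind: "integrable lborel (\<lambda>x. indicator A x * max 0 (s * f x))" if "A \<in> sets borel" for A s
    using integrable_mult_indicator[OF _ int, of A s] that by simp
  have emeasure_P: "emeasure (P s) A = ennreal (LINT x|lborel. indicator A x * max 0 (s * f x))"
    if [measurable]: "A \<in> sets borel" for A s
  proof -
    have "emeasure (P s) A = (\<integral>\<^sup>+x. ennreal (indicator A x * max 0 (s * f x)) \<partial>lborel)"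
      unfolding P_def by (subst emeasure_density) (auto intro!: nn_integral_cong simp: indicator_def)
    also have "\<dots> = ennreal (LINT x|lborel. indicator A x * max 0 (s * f x))"
      by (rule nn_integral_eq_integral) (auto intro: int_ind)
    finally show ?thesis .
  qed
  have fin: "finite_borel_measure (P s)" for s
  proof (intro finite_borel_measure.intro finite_measureI finite_borel_measure_axioms.intro)
    show "emeasure (P s) (space (P s)) \<noteq> \<infinity>"
      using emeasure_P[of UNIV s] by (simp add: P_def)
  qed (simp add: P_def)
  have "cdf (P 1) = cdf (P (-1))"
  proof
    fix a
    have "(LINT x|lborel. indicator {..a} x * max 0 (1 * f x))
        - (LINT x|lborel. indicator {..a} x * max 0 (-1 * f x)) = (LINT x|lborel. indicator {..a} x * f x)"
      by (subst Bochner_Integration.integral_diff[symmetric, OF int_ind int_ind])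
         (auto intro!: Bochner_Integration.integral_cong simp: indicator_def)
    then show "cdf (P 1) a = cdf (P (-1)) a"
      using zero[of a] by (simp add: cdf_def measure_def emeasure_P)
  qed
  then have "P 1 = P (-1)" by (rule cdf_unique'[OF fin fin])
  then have "AE x in lborel. ennreal (max 0 (1 * f x)) = ennreal (max 0 (- 1 * f x))"
    unfolding P_def by (intro sigma_finite_measure.density_unique[OF lborel.sigma_finite_measure_axioms]) auto
  then show ?thesis
    by eventually_elim (auto simp: max_def split: if_splits)
qed

lemma seg_ereal: "seg (ereal a) = {0..a}"
  by (auto simp: seg_def)

lemma seg_mono: "a \<le> b \<Longrightarrow> seg a \<subseteq> seg b"
  by (auto simp: seg_def intro: order_trans)

lemma sets_seg [measurable]: "seg a \<in> sets borel"
  by (cases a) (auto simp: seg_ereal seg_def)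

lemma sets_lebesgue_seg [measurable]: "seg a \<in> sets lebesgue"
  using sets_seg by (simp add: sets_completionI_sets)

text \<open>Both sides unfold to the same integral over the line against an indicator, so
  non-integrable \<open>g\<close> are covered too, with the default value 0 on both sides.\<close>

lemma integral_lebesgue_on_seg:
  fixes g :: "real \<Rightarrow> real"
  assumes "a \<le> T"
  shows "(LINT x|lebesgue_on (seg T). indicator (seg a) x * g x) = (LINT x|lebesgue_on (seg a). g x)"
  using seg_mono[OF assms]
  by (subst (1 2) integral_restrict_space)
     (auto intro!: Bochner_Integration.integral_cong simp: indicator_def)

lemma L2_space_eq: "L2_space T = square_integrable (lebesgue_on (seg T))"
  by (simp add: L2_space_def square_integrable_def)

lemma L2_norm_eq: "L2_norm T g = sqrt (L2_ip (lebesgue_on (seg T)) g g)"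
  by (simp add: L2_norm_def power2_eq_square)

lemma indicator_seg_square_integrable:
  "indicator (seg (ereal a)) \<in> square_integrable (lebesgue_on (seg T))"
proof -
  have "integrable lebesgue (indicat_real (seg T \<inter> {0..a}))"
  proof (rule integrable_real_indicator)
    have "emeasure lebesgue (seg T \<inter> {0..a}) \<le> emeasure lebesgue {0..a}"
      by (intro emeasure_mono) auto
    also have "\<dots> < \<infinity>" by (simp add: emeasure_lborel_Icc_eq)
    finally show "emeasure lebesgue (seg T \<inter> {0..a}) < \<infinity>" .
  qed auto
  then have "integrable (lebesgue_on (seg T)) (indicat_real {0..a})"
    by (subst integrable_restrict_space) (simp_all add: indicator_inter_arith[abs_def])
  then show ?thesis
    by (auto simp: square_integrable_def seg_ereal indicator_def power2_eq_square
        intro!: measurable_restrict_space1 elim!: back_subst[of "integrable _"])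
qed

text \<open>The problem is localised to \<open>{0..y}\<close> with \<open>y\<close> below
  \<open>T\<close>, where vanishing integrals over initial segments force the function to vanish;
  rational \<open>y\<close> then exhaust the segment up to its end point.\<close>

lemma AE_lebesgue_on_seg_zero:
  assumes n: "n \<in> square_integrable (lebesgue_on (seg T))"
    and zero: "\<And>y. 0 \<le> y \<Longrightarrow> ereal y < T \<Longrightarrow> (LINT x|lebesgue_on (seg (ereal y)). n x) = 0"
  shows "AE x in lebesgue_on (seg T). n x = 0"
proof -
  have AE_y: "AE x in lebesgue. x \<in> {0..y} \<longrightarrow> n x = 0" if y: "ereal y < T" for y
  proof -
    \<comment> \<open>On an unbounded segment \<open>n\<close> itself may fail to be integrable; its
      truncation is integrable.\<close>
    define f where "f = (\<lambda>x. indicator {0..y} x * n x)"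
    have sub: "{0..y} \<subseteq> seg T" using y seg_mono[of "ereal y" T] by (simp add: seg_ereal)
    have "integrable (lebesgue_on (seg T)) f"
      using square_integrable_mult[OF indicator_seg_square_integrable n, of y]
      by (simp add: f_def seg_ereal)
    then have f: "integrable lebesgue f"
      using sub by (subst (asm) integrable_restrict_space)
        (auto simp: f_def indicator_def if_distrib cong: if_cong
          elim!: back_subst[of "integrable _"] intro!: ext)
    \<comment> \<open>\<open>f\<close> is only Lebesgue measurable, so a Borel version is passed to
      the lemma about \<open>lborel\<close>.\<close>
    then obtain g where g[measurable]: "g \<in> borel_measurable lborel" and fg: "AE x in lborel. f x = g x"
      using completion_ex_borel_measurable_real[of f lborel] by auto
    have fgl: "AE x in lebesgue. f x = g x" using fg by (rule AE_completion)
    have gm: "g \<in> borel_measurable lebesgue" by (rule measurable_completion) simp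
    have fm: "f \<in> borel_measurable lebesgue" using f by auto
    have "integrable lebesgue g"
      using f integrable_cong_AE[OF fm gm fgl] by simp
    then have gi: "integrable lborel g" by (simp add: integrable_completion)
    have "(LINT x|lborel. indicator {..a} x * g x) = 0" for a
    proof -
      have "(LINT x|lborel. indicator {..a} x * g x) = (LINT x|lebesgue. indicator {..a} x * g x)"
        by (rule integral_completion[symmetric]) simp
      also have "\<dots> = (LINT x|lebesgue. indicator {..a} x * f x)"
        using fgl by (intro integral_cong_AE) (auto intro!: borel_measurable_times borel_measurable_indicator gm fm)
      also have "\<dots> = (LINT x|lebesgue. indicator (seg (ereal (min a y))) x * n x)"
        unfolding f_def seg_ereal
        by (intro Bochner_Integration.integral_cong) (auto simp: indicator_def)
      also have "\<dots> = (LINT x|lebesgue_on (seg (ereal (min a y))). n x)"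
        by (subst integral_restrict_space) auto
      also have "\<dots> = 0"
      proof (cases "0 \<le> min a y")
        case True
        have "ereal (min a y) < T" using y by (simp add: min_def order_le_less_trans[of _ "ereal y"])
        then show ?thesis using zero[OF True] by simp
      next
        case False
        then have "seg (ereal (min a y)) = {}" unfolding seg_ereal by simp
        then show ?thesis by (simp add: integral_eq_zero_null_sets)
      qed
      finally show ?thesis .
    qed
    then have "AE x in lborel. g x = 0"
      by (rule AE_lborel_zero_if_integral_atMost_zero[OF gi])
    then have "AE x in lebesgue. g x = 0" by (rule AE_completion)
    with fgl show ?thesis
      by eventually_elim (auto simp: f_def)
  qed
  \<comment> \<open>Rational end points keep the number of exceptional null sets countable.\<close>
  have "AE x in lebesgue. \<forall>y\<in>{y\<in>\<rat>. ereal y < T}. x \<in> {0..y} \<longrightarrow> n x = 0"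
    by (intro AE_ball_countable[THEN iffD2] ballI AE_y)
       (auto intro: countable_subset[OF _ countable_rat])
  \<comment> \<open>Removes a finite right end point; for infinite \<open>T\<close> the default
    \<open>real_of_ereal T = 0\<close> removes a harmless point.\<close>
  moreover have "AE x in lebesgue. x \<noteq> real_of_ereal T"
    by (intro AE_completion AE_lborel_singleton)
  ultimately have "AE x in lebesgue. x \<in> seg T \<longrightarrow> n x = 0"
  proof eventually_elim
    case (elim x)
    show ?case
    proof
      assume x: "x \<in> seg T"
      then have "ereal x < T" using elim(2) by (cases T) (auto simp: seg_def)
      then obtain z where z: "ereal x < z" "z < T" using dense by blast
      then obtain z' where z': "z = ereal z'" by (cases z) auto
      then obtain y where y: "y \<in> \<rat>" "x < y" "y < z'" using z Rats_dense_in_real[of x z'] by auto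
      then have "ereal y < T" using z(2) z' by (metis ereal_less_eq(3) less_imp_le order_le_less_trans)
      then show "n x = 0" using elim(1) y x by (auto simp: seg_def)
    qed
  qed
  then show ?thesis by (simp add: AE_restrict_space_iff)
qed

text \<open>The varying domain of integration becomes an indicator on the fixed segment, which makes
  point values inner products with features.\<close>

lemma represents_iff_L2_ip:
  assumes "\<And>t. t \<in> {0..1} \<Longrightarrow> q t \<le> T"
  shows "represents v q g F \<longleftrightarrow>
    (\<forall>t\<in>{0..1}. F t = L2_ip (lebesgue_on (seg T)) g (\<lambda>x. v t * indicator (seg (q t)) x))"
proof -
  have "L2_ip (lebesgue_on (seg T)) g (\<lambda>x. v t * indicator (seg (q t)) x)
      = v t * (LINT x|lebesgue_on (seg (q t)). g x)" if "t \<in> {0..1}" for t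
  proof -
    have "L2_ip (lebesgue_on (seg T)) g (\<lambda>x. v t * indicator (seg (q t)) x)
        = (LINT x|lebesgue_on (seg T). v t * (indicator (seg (q t)) x * g x))"
      by (simp add: ac_simps)
    then show ?thesis using integral_lebesgue_on_seg[OF assms[OF that]] by simp
  qed
  then show ?thesis by (simp add: represents_def)
qed

section \<open>The reproducing kernel Hilbert space of a Gauss-Markov process\<close>

theorem mainTheorem5:
  fixes M :: "'a measure" and \<Xi> :: "real \<Rightarrow> 'a \<Rightarrow> real"
    and u v :: "real \<Rightarrow> real" and q :: "real \<Rightarrow> ereal" and T :: ereal
  assumes "prob_space M"
    and "gaussian_process M \<Xi>" and "markov_process M \<Xi>"
    and centered: "\<And>t. t \<in> {0..1} \<Longrightarrow> (LINT \<omega>|M. \<Xi> t \<omega>) = 0"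
    and start: "AE \<omega> in M. \<Xi> 0 \<omega> = 0"
    and nondegenerate: "\<And>t. t \<in> {0<..<1} \<Longrightarrow> cov_kernel M \<Xi> t t > 0"
    and kernel: "\<And>s t. 0 \<le> s \<Longrightarrow> s \<le> t \<Longrightarrow> t \<le> 1 \<Longrightarrow> cov_kernel M \<Xi> s t = u s * v t"
    and "\<And>t. t \<in> {0..1} \<Longrightarrow> u t * v t \<ge> 0"
    and "\<And>t. t \<in> {0<..<1} \<Longrightarrow> u t * v t > 0"
    and q_quotient: "\<And>t. t \<in> {0..1} \<Longrightarrow> v t \<noteq> 0 \<Longrightarrow> q t = ereal (u t / v t)"
    and "continuous_on {0..<1} q"
    and "\<And>t. t \<in> {0..1} \<Longrightarrow> q t \<ge> 0"
    and "strict_mono_on {0..1} q"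
    and "q 0 = 0" and "T = q 1"
  shows "(\<exists>H ip. rkhs {0..1} (cov_kernel M \<Xi>) H ip) \<and>
    (\<forall>H ip. rkhs {0..1} (cov_kernel M \<Xi>) H ip \<longrightarrow>
       H = {F \<in> extensional {0..1}. \<exists>g\<in>L2_space T. represents v q g F} \<and>
       ((q \<longlongrightarrow> q 1) (at_left 1) \<longrightarrow>
          (\<forall>F\<in>H. \<forall>g\<in>L2_space T. represents v q g F \<longrightarrow> fnorm ip F = L2_norm T g)) \<and>
       (\<forall>F\<in>H. (\<exists>g\<in>L2_space T. represents v q g F \<and> fnorm ip F = L2_norm T g) \<and>
               (\<forall>g\<in>L2_space T. represents v q g F \<longrightarrow> fnorm ip F \<le> L2_norm T g)))"
proof -
  define N where "N = lebesgue_on (seg T)"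
  define \<phi> where "\<phi> t = (\<lambda>x. v t * indicator (seg (q t)) x)" for t
  have q_mono: "q s \<le> q t" if "0 \<le> s" "s \<le> t" "t \<le> 1" for s t
    using strict_mono_on_leD[OF \<open>strict_mono_on {0..1} q\<close>] that by simp
  have q_le: "q t \<le> T" if "t \<in> {0..1}" for t
    using q_mono[of t 1] that \<open>T = q 1\<close> by simp
  have v_nz: "v t \<noteq> 0" if "t \<in> {0<..<1}" for t
    using assms(9)[OF that] by auto
  have v_zero: "v t = 0" if "t \<in> {0..1}" "q t = \<infinity>" for t
    using q_quotient[OF that(1)] that(2) by auto
  \<comment> \<open>Where \<open>v t\<close> is nonzero, \<open>q t\<close> is a real quotient. An
    infinite segment thus carries the factor 0, and every feature is square-integrable.\<close>
  have q_cases: "v t = 0 \<or> (\<exists>a\<ge>0. q t = ereal a)" if "t \<in> {0..1}" for t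
    using q_quotient[OF that] assms(12)[OF that] by auto
  have \<phi>_L2: "\<phi> t \<in> square_integrable N" if t: "t \<in> {0..1}" for t
    using q_cases[OF t]
  proof
    assume "v t = 0"
    then show ?thesis by (simp add: \<phi>_def square_integrable_def)
  next
    assume "\<exists>a\<ge>0. q t = ereal a"
    then show ?thesis
      unfolding \<phi>_def N_def
      using square_integrable_scale[OF indicator_seg_square_integrable] by force
  qed
  have cov_0: "cov_kernel M \<Xi> 0 t = 0" if "t \<in> {0..1}" for t
    unfolding cov_kernel_def
    by (rule integral_eq_zero_AE) (use start in eventually_elim, simp add: centered)
  have gram_le: "cov_kernel M \<Xi> s t = L2_ip N (\<phi> s) (\<phi> t)" if st: "0 \<le> s" "s \<le> t" "t \<le> 1" for s t
  proof (cases "v s = 0")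
    case True
    \<comment> \<open>At \<open>s = 0\<close> the covariance vanishes because the process starts at
      0; at \<open>s = 1\<close> also \<open>t = 1\<close>, and the factor \<open>v t\<close> is
      0.\<close>
    then have "s = 0 \<or> s = 1" using v_nz[of s] st by fastforce
    then have "cov_kernel M \<Xi> s t = 0"
      using cov_0[of t] kernel[OF st] True st by auto
    then show ?thesis using True by (simp add: \<phi>_def)
  next
    case False
    have s: "s \<in> {0..1}" using st by simp
    obtain a where a: "0 \<le> a" "q s = ereal a" using q_cases[OF s] False by auto
    \<comment> \<open>The shorter segment absorbs the longer one, leaving \<open>v s * v t\<close>
      times its length \<open>q s = u s / v s\<close>.\<close>
    have "L2_ip N (\<phi> s) (\<phi> t) = (LINT x|N. (v s * v t) * (indicator (seg (q s)) x * 1))"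
      using seg_mono[OF q_mono[OF st]]
      by (intro Bochner_Integration.integral_cong) (auto simp: \<phi>_def indicator_def)
    also have "\<dots> = v s * v t * (LINT x|lebesgue_on (seg (q s)). 1)"
      unfolding N_def by (subst integral_mult_right_zero) (simp only: integral_lebesgue_on_seg[OF q_le[OF s]])
    also have "(LINT x|lebesgue_on (seg (q s)). 1) = a"
      using a by (simp add: seg_ereal measure_restrict_space)
    also have "v s * v t * a = u s * v t"
      using q_quotient[OF s False] a False by simp
    finally show ?thesis using kernel[OF st] by simp
  qed
  have gram: "cov_kernel M \<Xi> s t = L2_ip N (\<phi> s) (\<phi> t)" if "s \<in> {0..1}" "t \<in> {0..1}" for s t
  proof (cases "s \<le> t")
    case True
    then show ?thesis using gram_le that by simp
  next
    case False
    have "cov_kernel M \<Xi> s t = cov_kernel M \<Xi> t s" by (simp add: cov_kernel_def mult.commute)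
    also have "\<dots> = L2_ip N (\<phi> t) (\<phi> s)" using False that by (intro gram_le) auto
    finally show ?thesis by (simp add: mult.commute)
  qed
  interpret FM: L2_feature_map N "{0..1}" \<phi> "cov_kernel M \<Xi>"
    by unfold_locales (simp_all add: \<phi>_L2 gram)
  have rep_iff: "represents v q g F \<longleftrightarrow> (\<forall>t\<in>{0..1}. F t = L2_ip N g (\<phi> t))" for g F
    unfolding N_def \<phi>_def by (rule represents_iff_L2_ip[OF q_le])
  have L2: "L2_space T = square_integrable N" by (simp add: L2_space_eq N_def)
  have norm_eq: "L2_norm T g = sqrt (L2_ip N g g)" for g by (simp add: L2_norm_eq N_def)
  have unique: "L2_norm T g = L2_norm T g'"
    if g: "g \<in> L2_space T" "g' \<in> L2_space T" and rep: "represents v q g F" "represents v q g' F"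
      and lim: "(q \<longlongrightarrow> q 1) (at_left 1)" for g g' F
  proof -
    let ?n = "\<lambda>x. g x + (-1) * g' x"
    have n: "?n \<in> square_integrable N" using square_integrable_diff[of g N g'] g by (simp add: L2)
    \<comment> \<open>The difference of two representing functions represents zero; it remains to
      see that its integrals over all shorter segments vanish.\<close>
    have "represents v q ?n (\<lambda>_. 0)"
      unfolding rep_iff
    proof
      fix t :: real assume t: "t \<in> {0..1}"
      have "L2_ip N ?n (\<phi> t) = L2_ip N g (\<phi> t) + L2_ip N (\<lambda>x. (-1) * g' x) (\<phi> t)"
        using g \<phi>_L2[OF t] by (intro L2.B_plus square_integrable_scale) (simp_all add: L2)
      also have "\<dots> = 0" using rep t unfolding rep_iff by simp
      finally show "0 = L2_ip N ?n (\<phi> t)" by simp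
    qed
    then have n0: "v t * (LINT x|lebesgue_on (seg (q t)). ?n x) = 0" if "t \<in> {0..1}" for t
      using that by (simp add: represents_def)
    have "(LINT x|lebesgue_on (seg (ereal y)). ?n x) = 0" if y: "0 \<le> y" "ereal y < T" for y
    proof (cases "y = 0")
      \<comment> \<open>Here the only preimage of \<open>y\<close> under \<open>q\<close> is 0,
        where \<open>v\<close> might vanish; the segment is a single point.\<close>
      case True
      then have "seg (ereal y) = {0}" by (simp add: seg_ereal)
      then show ?thesis by (simp add: integral_eq_zero_null_sets)
    next
      case False
      have "\<forall>\<^sub>F t in at_left 1. ereal y < q t"
        using lim y(2) \<open>T = q 1\<close> by (auto intro: order_tendstoD)
      then obtain b where b: "b < 1" "\<And>t. b < t \<Longrightarrow> t < 1 \<Longrightarrow> ereal y < q t"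
        by (auto simp: eventually_at_left_field)
      \<comment> \<open>The midpoint between \<open>max 0 b\<close> and 1 lies in [0,1) and above
        \<open>b\<close>, so \<open>q s\<close> exceeds \<open>y\<close>. The intermediate value
        theorem on [0,s] avoids the end point 1.\<close>
      define s where "s = (max 0 b + 1) / 2"
      have s: "0 \<le> s" "s < 1" "b < s" using b(1) by (auto simp: s_def max_def)
      have "continuous_on {0..s} q"
        using \<open>continuous_on {0..<1} q\<close> by (rule continuous_on_subset) (use s in auto)
      then obtain t where t: "0 \<le> t" "t \<le> s" "q t = ereal y"
        using IVT'[of q 0 "ereal y" s] less_imp_le[OF b(2)[OF s(3,2)]] y(1) s \<open>q 0 = 0\<close> by auto
      \<comment> \<open>Now \<open>t\<close> is interior, so the nonzero factor \<open>v t\<close>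
        can be cancelled in \<open>n0\<close>.\<close>
      have "t \<noteq> 0" using t(3) False \<open>q 0 = 0\<close> by auto
      then have "v t \<noteq> 0" using v_nz[of t] t s by simp
      then show ?thesis using n0[of t] t s by simp
    qed
    then have "AE x in N. ?n x = 0"
      using n unfolding N_def by (rule AE_lebesgue_on_seg_zero[rotated])
    then have "AE x in N. g x * g x = g' x * g' x" by eventually_elim simp
    then have "L2_ip N g g = L2_ip N g' g'"
      using g by (intro integral_cong_AE) (auto simp: L2 dest: square_integrable_measurable)
    then show ?thesis by (simp add: norm_eq)
  qed
  show ?thesis
  proof (intro conjI allI impI)
    show "\<exists>H ip. rkhs {0..1} (cov_kernel M \<Xi>) H ip" using FM.rkhs_eval by blast
  next
    fix H ip assume rk: "rkhs {0..1} (cov_kernel M \<Xi>) H ip"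
    then interpret H: rkhs "{0..1}" "cov_kernel M \<Xi>" H ip .
    have upper: "F \<in> H \<and> fnorm ip F \<le> L2_norm T g"
      if "F \<in> extensional {0..1}" "g \<in> L2_space T" "represents v q g F" for F g
      using FM.rkhs_mem_of_L2[OF rk _ that(1)] that(2,3)
      by (auto simp: L2 rep_iff fnorm_def norm_eq)
    \<comment> \<open>The transferred \<open>g\<close> has norm at most that of \<open>F\<close>,
      while \<open>upper\<close> gives the reverse inequality for every representing function; so
      the minimum is attained.\<close>
    have lower: "\<exists>g\<in>L2_space T. represents v q g F \<and> fnorm ip F = L2_norm T g" if F: "F \<in> H" for F
    proof -
      obtain g where g: "g \<in> square_integrable N" "\<And>t. t \<in> {0..1} \<Longrightarrow> F t = L2_ip N g (\<phi> t)"
        "L2_ip N g g \<le> ip F F"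
        using FM.L2_of_rkhs_mem[OF rk F] by blast
      have gL: "g \<in> L2_space T" and rep: "represents v q g F" using g by (auto simp: L2 rep_iff)
      have "fnorm ip F \<le> L2_norm T g" using upper gL rep F H.carrier by blast
      moreover have "L2_norm T g \<le> fnorm ip F" using g(3) by (simp add: norm_eq fnorm_def)
      ultimately show ?thesis using gL rep by force
    qed
    show "H = {F \<in> extensional {0..1}. \<exists>g\<in>L2_space T. represents v q g F}"
      using upper lower H.carrier by blast
    show "\<forall>F\<in>H. (\<exists>g\<in>L2_space T. represents v q g F \<and> fnorm ip F = L2_norm T g) \<and>
      (\<forall>g\<in>L2_space T. represents v q g F \<longrightarrow> fnorm ip F \<le> L2_norm T g)"
      using upper lower H.carrier by blast
    show "\<forall>F\<in>H. \<forall>g\<in>L2_space T. represents v q g F \<longrightarrow> fnorm ip F = L2_norm T g"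
      if "(q \<longlongrightarrow> q 1) (at_left 1)"
      using lower unique that by metis
  qed
qed

end
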